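(* Let $m\ge 2$ be an integer. Then $\mathcal{V}_m=\mathcal{W}_m$ and $\mathcal{W}_m\subset\mathcal{Y}_m$.
   Context: $[m]=\{1,\dots,m\}$ and $\mathfrak{S}_m$ is the set of all bijections $[m]\to[m]$. For a predicate $P$, $\mathbf{1}(P)=1$ if $P$ is true and $0$ if $P$ is false. For $m\ge 2$: $$\mathcal{V}_m=\{\theta\in\mathfrak{S}_m:\ \theta(i+1)-\theta(i)\equiv\theta(1)-\mathbf{1}(\theta(m)\le\theta(i)) \pmod m\ \text{ for all } i\in[m-1]\},$$ $$\mathcal{W}_m=\{\theta\in\mathfrak{S}_m:\ \theta(i+1)-\theta(i)=\theta(1)-\mathbf{1}(\theta(m)\le\theta(i))+m(\mathbf{1}(\theta(i)\le\theta(i+1))-1)\ \text{ for all } i\in[m-1]\}.$$ For $\theta\in\mathfrak{S}_m$ and $i\in[m-1]$ put $$\Delta_\theta(i)=\theta(i+1)-\theta(i)+\mathbf{1}(\theta(m)\le\theta(i))-\mathbf{1}(\theta(1)\le\theta(i+1))-(m-1)\mathbf{1}(\theta(i)\le\theta(i+1)).$$ For $m\ge 3$, $\mathcal{Y}_m=\{\theta\in\mathfrak{S}_m:\ \Delta_\theta(i+1)-\Delta_\theta(i)=0\ \text{ for all } i\in[m-2]\}$, and $\mathcal{Y}_2=\mathfrak{S}_2$. *)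

theory Defs
  imports "HOL-Combinatorics.Permutations" "HOL-Number_Theory.Cong"
begin

text \<open>A bijection of \<open>[m]\<close> is represented by the function on \<^typ>\<open>nat\<close> that extends it by
  the identity outside \<open>{1..m}\<close> (\<^term>\<open>\<theta> permutes {1..m}\<close>). Differences of values are taken
  in \<^typ>\<open>int\<close>, and \<^const>\<open>of_bool\<close> is the 0/1 indicator of a predicate.\<close>

definition Sym :: "nat \<Rightarrow> (nat \<Rightarrow> nat) set" where
  "Sym m = {\<theta>. \<theta> permutes {1..m}}"

definition V :: "nat \<Rightarrow> (nat \<Rightarrow> nat) set" where
  "V m = {\<theta> \<in> Sym m. \<forall>i \<in> {1..m - 1}.
     [int (\<theta> (i + 1)) - int (\<theta> i) = int (\<theta> 1) - of_bool (\<theta> m \<le> \<theta> i)] (mod int m)}"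

definition W :: "nat \<Rightarrow> (nat \<Rightarrow> nat) set" where
  "W m = {\<theta> \<in> Sym m. \<forall>i \<in> {1..m - 1}.
     int (\<theta> (i + 1)) - int (\<theta> i) =
       int (\<theta> 1) - of_bool (\<theta> m \<le> \<theta> i) + int m * (of_bool (\<theta> i \<le> \<theta> (i + 1)) - 1)}"

definition Delta :: "nat \<Rightarrow> (nat \<Rightarrow> nat) \<Rightarrow> nat \<Rightarrow> int" where
  "Delta m \<theta> i = int (\<theta> (i + 1)) - int (\<theta> i) + of_bool (\<theta> m \<le> \<theta> i)
     - of_bool (\<theta> 1 \<le> \<theta> (i + 1)) - (int m - 1) * of_bool (\<theta> i \<le> \<theta> (i + 1))"

definition Y :: "nat \<Rightarrow> (nat \<Rightarrow> nat) set" where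
  "Y m = (if m = 2 then Sym 2
          else {\<theta> \<in> Sym m. \<forall>i \<in> {1..m - 2}. Delta m \<theta> (i + 1) - Delta m \<theta> i = 0})"

end

theory Submission
  imports Defs
begin

text \<open>Put \<open>r = \<theta>(1) - 1(\<theta>(m) \<le> \<theta>(i))\<close>, so \<open>0 \<le> r \<le> m\<close>. The difference \<open>\<theta>(i+1) - \<theta>(i)\<close>
  is nonzero and lies strictly between \<open>-m\<close> and \<open>m\<close>, so its congruence to \<open>r\<close> modulo \<open>m\<close>
  forces it to be \<open>r\<close> at an ascent and \<open>r - m\<close> at a descent. For elements of \<open>W m\<close>
  this makes \<open>i\<close> an ascent exactly when \<open>\<theta>(1) \<le> \<theta>(i+1)\<close>, whence
  \<open>\<Delta>(i) = \<theta>(1) - m\<close> for every \<open>i\<close>.\<close>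

lemma Sym_bounds:
  assumes "\<theta> \<in> Sym m" "i \<in> {1..m}"
  shows "1 \<le> \<theta> i" "\<theta> i \<le> m"
  using permutes_in_image[of \<theta> "{1..m}" i] assms by (auto simp: Sym_def)

lemma Sym_consecutive_neq:
  assumes "\<theta> \<in> Sym m"
  shows "\<theta> (i + 1) \<noteq> \<theta> i"
  using permutes_inj[of \<theta> "{1..m}"] assms by (auto simp: Sym_def dest: injD)

lemma cong_iff_eq_shift:
  fixes d r m :: int
  assumes "d \<noteq> 0" "\<bar>d\<bar> < m" "0 \<le> r" "r \<le> m"
  shows "[d = r] (mod m) \<longleftrightarrow> d = r + m * (of_bool (0 \<le> d) - 1)"
proof
  assume cong: "[d = r] (mod m)"
  have nd: "\<not> m dvd d"
    using assms zdvd_imp_le[of m "\<bar>d\<bar>"] by auto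
  then have "\<not> m dvd r"
    using cong by (simp add: cong_dvd_iff[OF cong_sym])
  \<comment> \<open>The bounds allow \<open>r = m\<close>, where \<open>r mod m\<close> would be 0
    instead of \<open>r\<close>; this is excluded since \<open>m\<close> divides itself but not
    \<open>r\<close>.\<close>
  then have "r \<noteq> 0" "r \<noteq> m" by auto
  then have "r mod m = r" using assms by simp
  moreover have "d mod m = (if 0 \<le> d then d else d + m)"
    using assms mod_add_self2[of d m] by (auto simp del: mod_add_self2 simp: mod_pos_pos_trivial)
  ultimately show "d = r + m * (of_bool (0 \<le> d) - 1)"
    using cong by (auto simp: cong_def split: if_splits)
next
  assume "d = r + m * (of_bool (0 \<le> d) - 1)"
  then show "[d = r] (mod m)"
    by (metis cong_iff_lin cong_sym)
qed

lemma V_eq_W: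
  assumes "m \<ge> 2"
  shows "V m = W m"
proof -
  have "[int (\<theta> (i + 1)) - int (\<theta> i) = int (\<theta> 1) - of_bool (\<theta> m \<le> \<theta> i)] (mod int m) \<longleftrightarrow>
      int (\<theta> (i + 1)) - int (\<theta> i) =
        int (\<theta> 1) - of_bool (\<theta> m \<le> \<theta> i) + int m * (of_bool (\<theta> i \<le> \<theta> (i + 1)) - 1)"
    if "\<theta> \<in> Sym m" "i \<in> {1..m - 1}" for \<theta> i
  proof -
    have bounds: "1 \<le> \<theta> i" "\<theta> i \<le> m" "1 \<le> \<theta> (i + 1)" "\<theta> (i + 1) \<le> m" "1 \<le> \<theta> 1" "\<theta> 1 \<le> m"
      by (rule Sym_bounds[OF that(1)]; use that(2) assms in auto)+
    show ?thesis
      using cong_iff_eq_shift[of "int (\<theta> (i + 1)) - int (\<theta> i)" "int m"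
          "int (\<theta> 1) - of_bool (\<theta> m \<le> \<theta> i)"]
        Sym_consecutive_neq[OF that(1), of i] bounds
      by (simp add: abs_less_iff of_bool_def)
  qed
  then show ?thesis
    unfolding V_def W_def by blast
qed

lemma Delta_W:
  assumes "\<theta> \<in> W m" "i \<in> {1..m - 1}"
  shows "Delta m \<theta> i = int (\<theta> 1) - int m"
proof -
  have \<theta>: "\<theta> \<in> Sym m" and step: "int (\<theta> (i + 1)) - int (\<theta> i) =
      int (\<theta> 1) - of_bool (\<theta> m \<le> \<theta> i) + int m * (of_bool (\<theta> i \<le> \<theta> (i + 1)) - 1)"
    using assms by (auto simp: W_def)
  have bounds: "1 \<le> \<theta> i" "\<theta> i \<le> m" "\<theta> m \<le> m"
    using Sym_bounds[OF \<theta>, of i] Sym_bounds[OF \<theta>, of m] assms(2) by auto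
  have "\<theta> i \<le> \<theta> (i + 1) \<longleftrightarrow> \<theta> 1 \<le> \<theta> (i + 1)"
  proof (cases "\<theta> i \<le> \<theta> (i + 1)")
    case True
    \<comment> \<open>Here \<open>\<theta> (i + 1)\<close> is \<open>\<theta> 1 + \<theta> i\<close>
      minus an indicator, and \<open>1 \<le> \<theta> i\<close> absorbs that indicator.\<close>
    then show ?thesis using step bounds by (auto simp: of_bool_def split: if_splits)
  next
    case False
    \<comment> \<open>If \<open>\<theta>(i) = m\<close>, then \<open>\<theta>(m) \<le> \<theta>(i)\<close>, so the inequality stays strict.\<close>
    then show ?thesis using step bounds by (auto simp: of_bool_def split: if_splits)
  qed
  \<comment> \<open>With \<open>a\<close> the common value of the two indicators,
    \<open>Delta m \<theta> i\<close> is \<open>\<theta> 1 + m * (a - 1) - a - (m - 1) * a\<close>,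
    where \<open>a\<close> cancels.\<close>
  then show ?thesis
    using step by (auto simp: Delta_def of_bool_def algebra_simps)
qed

lemma W_subset_Y: "W m \<subseteq> Y m"
proof
  fix \<theta> assume \<theta>: "\<theta> \<in> W m"
  then have "\<theta> \<in> Sym m" by (simp add: W_def)
  then show "\<theta> \<in> Y m"
    using Delta_W[OF \<theta>] by (auto simp: Y_def)
qed

theorem theorem1:
  fixes m :: nat
  assumes "m \<ge> 2"
  shows "V m = W m \<and> W m \<subseteq> Y m"
  using V_eq_W[OF assms] W_subset_Y by simp

end
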